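(* Let $\rho>1$, $\lambda\in\mathbb{C}$, and let $I_n(R_nz;\lambda)=(1-\lambda)s_n(R_nz)-\lambda t_{n+1}(R_nz)$, where $s_n,t_{n+1}$ are the sections and tails of the Mittag--Leffler function $E_{1/\rho}$. Then, as $n\to\infty$, $$\left(1+\left(\tfrac{2}{\rho n}\right)^{1/2}\zeta\right)^{-n}\left\{E_{1/\rho}(R_n)\right\}^{-1}I_n\left(R_n\left(1+\left(\tfrac{2}{\rho n}\right)^{1/2}\zeta\right);\lambda\right)\to e^{\zeta^2}\left\{\frac{\operatorname{erfc}(\zeta)}{2}-\lambda\right\}$$ uniformly on every compact set of the $\zeta$-plane.
   Context: For $\rho>1$, $E_{1/\rho}(z)=\sum_{j=0}^\infty \frac{z^j}{\Gamma(1+j/\rho)}$ is the Mittag--Leffler function of order $\rho$. Its sections and tails are $s_n(z)=\sum_{k=0}^n\frac{z^k}{\Gamma(1+k/\rho)}$ and $t_n(z)=\sum_{k=n}^\infty\frac{z^k}{\Gamma(1+k/\rho)}$. For $n\ge1$, $R_n=\frac{\Gamma(1+n/\rho)}{\Gamma(1+(n-1)/\rho)}$. The complementary error function is $\operatorname{erfc}(\zeta)=1-\frac{2}{\sqrt{\pi}}\int_0^\zeta e^{-v^2}\,dv$ for $\zeta\in\mathbb{C}$. *)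

theory Defs
  imports "HOL-Complex_Analysis.Contour_Integration"
begin

text \<open>The parameter \<open>\<rho>\<close> is the order, so that \<open>mittag_leffler \<rho>\<close> is the function usually
  written \<open>E\<close> with index \<open>1/\<rho>\<close>.\<close>

definition ml_term :: "real \<Rightarrow> nat \<Rightarrow> complex \<Rightarrow> complex" where
  "ml_term \<rho> k z = z ^ k / of_real (Gamma (1 + real k / \<rho>))"

definition mittag_leffler :: "real \<Rightarrow> complex \<Rightarrow> complex" where
  "mittag_leffler \<rho> z = (\<Sum>j. ml_term \<rho> j z)"

definition ml_section :: "real \<Rightarrow> nat \<Rightarrow> complex \<Rightarrow> complex" where
  "ml_section \<rho> n z = (\<Sum>k\<le>n. ml_term \<rho> k z)"

definition ml_tail :: "real \<Rightarrow> nat \<Rightarrow> complex \<Rightarrow> complex" where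
  "ml_tail \<rho> n z = (\<Sum>k. ml_term \<rho> (k + n) z)"

text \<open>Only meaningful for \<open>n \<ge> 1\<close>.\<close>

definition ml_R :: "real \<Rightarrow> nat \<Rightarrow> real" where
  "ml_R \<rho> n = Gamma (1 + real n / \<rho>) / Gamma (1 + (real n - 1) / \<rho>)"

definition ml_I :: "real \<Rightarrow> complex \<Rightarrow> nat \<Rightarrow> complex \<Rightarrow> complex" where
  "ml_I \<rho> lam n w = (1 - lam) * ml_section \<rho> n w - lam * ml_tail \<rho> (n + 1) w"

text \<open>The integrand is entire, so the integral from \<open>0\<close> to \<open>\<zeta>\<close> does not depend on the path;
  the straight segment is used.\<close>

definition erfc :: "complex \<Rightarrow> complex" where
  "erfc \<zeta> = 1 - 2 / of_real (sqrt pi) * contour_integral (linepath 0 \<zeta>) (\<lambda>v. exp (- v\<^sup>2))"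

end

theory Submission
  imports Defs "HOL-Complex_Analysis.Cauchy_Integral_Theorem" "HOL-Probability.Sinc_Integral"
    "HOL-Real_Asymp.Real_Asymp"
begin

text \<open>
  Since \<open>I\<^sub>n = s\<^sub>n - \<lambda> E\<close>, everything reduces to \<open>s\<^sub>n\<close> and \<open>t\<^sub>n\<^sub>+\<^sub>1\<close>. At \<open>R\<^sub>n\<close> the terms of index \<open>n - 1\<close>
  and \<open>n\<close> are equal and maximal. With \<open>h = (2/(\<rho>n))\<^sup>1\<^sup>/\<^sup>2\<close>, a second-order Taylor expansion of the
  logarithm of the Gamma function shows that the term of index \<open>n + j\<close> at \<open>R\<^sub>n\<close>, divided by that of
  index \<open>n\<close>, tends to \<open>exp (-x\<^sup>2/4)\<close> when \<open>jh \<rightarrow> x\<close>, while \<open>(1 + h\<zeta>)\<^sup>j \<rightarrow> exp (x\<zeta>)\<close>. So, after division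
  by the \<open>n\<close>-th term at \<open>R\<^sub>n (1 + h\<zeta>)\<close>, \<open>h s\<^sub>n\<close> and \<open>h t\<^sub>n\<^sub>+\<^sub>1\<close> are Riemann sums of \<open>exp (-x\<^sup>2/4 + x\<zeta>)\<close> over the negative and
  the positive half-line. They converge by domination, to \<open>\<surd>\<pi> exp (\<zeta>\<^sup>2) erfc (\<zeta>)\<close> and
  \<open>\<surd>\<pi> exp (\<zeta>\<^sup>2) erfc (-\<zeta>)\<close>. Taking \<open>\<zeta> = 0\<close> gives \<open>E(R\<^sub>n)\<close>. Uniformity on compact sets follows because
  \<open>\<zeta>\<close> may vary with \<open>n\<close> along a convergent sequence.
\<close>

section \<open>Second-order behaviour of the terms around index n\<close>

lemma telescoping_reciprocals_sums:
  fixes x :: real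
  assumes "x > 0"
  shows "(\<lambda>k. 1 / (x + real k) - 1 / (x + real (Suc k))) sums (1 / x)"
proof -
  have "(\<lambda>k. 1 / (x + real k)) \<longlonglongrightarrow> 0"
    by real_asymp
  from telescope_sums'[OF this] show ?thesis by simp
qed

text \<open>Termwise comparison of the series of 1/(x+k)^2 with the telescoping series of
  1/((x+k)(x+k+1)), whose sum is 1/x. Both bounds agree to leading order, which is what pins down
  the Gaussian exponent later.\<close>

lemma trigamma_bounds:
  fixes x :: real
  assumes "x > 0"
  shows "1 / x \<le> Polygamma 1 x" and "Polygamma 1 x \<le> 1 / x + 1 / x\<^sup>2"
proof -
  have S: "(\<lambda>k. inverse ((x + real k)\<^sup>2)) sums Polygamma 1 x"
    using Polygamma_LIMSEQ[of x 1] assms by (simp add: numeral_2_eq_2)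
  show "1 / x \<le> Polygamma 1 x"
  proof (rule sums_le[OF _ telescoping_reciprocals_sums[OF assms] S])
    fix k
    have "1 / (x + real k) - 1 / (x + real (Suc k)) = inverse ((x + real k) * (x + real k + 1))"
      using assms by (simp add: field_simps)
    also have "\<dots> \<le> inverse ((x + real k)\<^sup>2)"
      using assms by (intro le_imp_inverse_le) (auto simp: power2_eq_square)
    finally show "1 / (x + real k) - 1 / (x + real (Suc k)) \<le> inverse ((x + real k)\<^sup>2)" .
  qed
  \<comment> \<open>The term k = 0 is split off; each later term then lies below the telescoping
    term with index one lower.\<close>
  have S': "(\<lambda>k. inverse ((x + real (Suc k))\<^sup>2)) sums (Polygamma 1 x - 1 / x\<^sup>2)"
    using S by (subst sums_Suc_iff) (simp add: inverse_eq_divide)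
  have "Polygamma 1 x - 1 / x\<^sup>2 \<le> 1 / x"
  proof (rule sums_le[OF _ S' telescoping_reciprocals_sums[OF assms]])
    fix k
    have "0 < x + real k" using assms by simp
    then have "0 < (x + real k) * (x + real k + 1)" by simp
    moreover have "(x + real k) * (x + real k + 1) \<le> (x + real k + 1)\<^sup>2"
      using assms by (simp add: power2_eq_square algebra_simps)
    ultimately have "inverse ((x + real k + 1)\<^sup>2) \<le> inverse ((x + real k) * (x + real k + 1))"
      by (rule le_imp_inverse_le[rotated])
    also have "\<dots> = 1 / (x + real k) - 1 / (x + real (Suc k))"
      using assms by (simp add: field_simps)
    finally show "inverse ((x + real (Suc k))\<^sup>2) \<le> 1 / (x + real k) - 1 / (x + real (Suc k))"
      by (simp add: add_ac)
  qed
  then show "Polygamma 1 x \<le> 1 / x + 1 / x\<^sup>2" by simp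
qed

text \<open>Lagrange's form of Taylor's formula. The bounds by \<open>min\<close> and
  \<open>max\<close> cover steps of either sign, and the step 0, which Taylor's theorem excludes and
  which is treated apart.\<close>

lemma ln_Gamma_taylor:
  fixes y s :: real
  assumes "y > 0" "y + s > 0"
  obtains \<xi> where "min y (y + s) \<le> \<xi>" "\<xi> \<le> max y (y + s)"
    "ln_Gamma (y + s) = ln_Gamma y + s * Digamma y + s\<^sup>2 / 2 * Polygamma 1 \<xi>"
proof (cases "s = 0")
  case True
  then show ?thesis using that[of y] by simp
next
  case False
  define diff :: "nat \<Rightarrow> real \<Rightarrow> real" where
    "diff = (\<lambda>m. if m = 0 then ln_Gamma else Polygamma (m - 1))"
  have D: "\<forall>m t. m < 2 \<and> min y (y + s) \<le> t \<and> t \<le> max y (y + s) \<longrightarrow> DERIV (diff m) t :> diff (Suc m) t"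
  proof (intro allI impI, elim conjE)
    fix m :: nat and t :: real
    assume m: "m < 2" and "min y (y + s) \<le> t"
    then have t: "t > 0" using assms by linarith
    then have "t \<notin> \<int>\<^sub>\<le>\<^sub>0" by (auto elim!: nonpos_Ints_cases)
    then show "DERIV (diff m) t :> diff (Suc m) t"
      using m t has_field_derivative_Polygamma[of t 0]
      by (cases m) (auto simp: diff_def less_Suc_eq numeral_2_eq_2 intro: has_field_derivative_ln_Gamma_real)
  qed
  from Taylor[of 2 diff ln_Gamma "min y (y + s)" "max y (y + s)" y "y + s", OF _ _ D] False
  obtain t where "if y + s < y then y + s < t \<and> t < y else y < t \<and> t < y + s"
    and "ln_Gamma (y + s) = (\<Sum>m<2. (diff m y / fact m) * (y + s - y)^m) + (diff 2 t / fact 2) * (y + s - y)^2"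
    by (auto simp: diff_def)
  then show ?thesis
    using that[of t] by (auto simp: diff_def eval_nat_numeral split: if_splits)
qed

text \<open>The logarithm of the quotient of the terms of index \<open>n + t\<close> and \<open>n\<close> of the series at \<open>R\<^sub>n\<close>,
  for real \<open>t\<close>.\<close>

definition ml_log_ratio :: "real \<Rightarrow> nat \<Rightarrow> real \<Rightarrow> real" where
  "ml_log_ratio \<rho> n t =
     t * (ln_Gamma (1 + real n / \<rho>) - ln_Gamma (1 + (real n - 1) / \<rho>))
       - (ln_Gamma (1 + (real n + t) / \<rho>) - ln_Gamma (1 + real n / \<rho>))"

text \<open>Both \<open>ln R_n\<close> and the increment of ln Gamma over t/\<rho> are expanded at
  the same point y, so the Digamma terms cancel. What remains is a linear error of size at most
  |t|/(\<rho> n) and -(t/\<rho>)^2/2 times a trigamma value, to which the two trigamma bounds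
  apply.\<close>

lemma ml_log_ratio_bounds:
  fixes \<rho> t :: real and n :: nat
  assumes "\<rho> > 1" "n > 0"
  defines "y \<equiv> 1 + real n / \<rho>"
  shows "y + t / \<rho> > 0 \<Longrightarrow>
      ml_log_ratio \<rho> n t \<le> \<bar>t\<bar> / (\<rho> * real n) - (t / \<rho>)\<^sup>2 / 2 / (y + \<bar>t\<bar> / \<rho>)"
    and "\<bar>t\<bar> / \<rho> < y \<Longrightarrow>
      - (\<bar>t\<bar> / (\<rho> * real n)) - (t / \<rho>)\<^sup>2 / 2 * (1 / (y - \<bar>t\<bar> / \<rho>) + 1 / (y - \<bar>t\<bar> / \<rho>)\<^sup>2)
        \<le> ml_log_ratio \<rho> n t"
proof -
  define a where "a = 1 / \<rho>"
  have a: "0 < a" "a < 1" using assms by (auto simp: a_def)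
  have y: "y = 1 + real n * a" by (simp add: y_def a_def)
  have n: "real n \<ge> 1" using assms by simp
  \<comment> \<open>Since y - a = 1 + (n-1)a = na + (1-a), the first bound uses n \<ge> 1 and the
    second uses a < 1, that is \<rho> > 1.\<close>
  have ya: "y - a \<ge> 1" "y - a \<ge> real n * a" "y > 0"
    using a n mult_right_mono[of 1 "real n" a] unfolding y by linarith+
  obtain \<xi> where \<xi>: "y - a \<le> \<xi>" "\<xi> \<le> y"
    "ln_Gamma (y - a) = ln_Gamma y - a * Digamma y + a\<^sup>2 / 2 * Polygamma 1 \<xi>"
    using ln_Gamma_taylor[of y "-a"] ya a by (auto simp: min_def max_def split: if_splits)
  \<comment> \<open>The contribution of the second-order remainder in \<open>ln R_n\<close>,
    multiplied by t.\<close>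
  define \<delta> where "\<delta> = t * (a\<^sup>2 / 2 * Polygamma 1 \<xi>)"
  have "Polygamma 1 \<xi> \<le> 1 / \<xi> + 1 / \<xi>\<^sup>2" "0 \<le> Polygamma 1 \<xi>"
    using trigamma_bounds[of \<xi>] \<xi> ya by (auto intro: order_trans[rotated])
  moreover have "1 / \<xi>\<^sup>2 \<le> 1 / \<xi>"
    using \<xi> ya by (auto simp: field_simps power2_eq_square)
  moreover have "1 / \<xi> \<le> 1 / (real n * a)"
    using \<xi> ya a n by (intro divide_left_mono) auto
  ultimately have P: "0 \<le> Polygamma 1 \<xi>" "Polygamma 1 \<xi> \<le> 2 / (real n * a)" by auto
  have "\<bar>\<delta>\<bar> = \<bar>t\<bar> * (a\<^sup>2 / 2 * Polygamma 1 \<xi>)" using P by (simp add: \<delta>_def abs_mult)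
  also have "\<dots> \<le> \<bar>t\<bar> * (a\<^sup>2 / 2 * (2 / (real n * a)))"
    using P by (intro mult_left_mono) auto
  also have "\<dots> = \<bar>t\<bar> / (\<rho> * real n)"
    using a by (simp add: a_def power2_eq_square field_simps)
  finally have \<delta>: "\<bar>\<delta>\<bar> \<le> \<bar>t\<bar> / (\<rho> * real n)" .
  have L: "ml_log_ratio \<rho> n t = t * (ln_Gamma y - ln_Gamma (y - a)) - (ln_Gamma (y + t * a) - ln_Gamma y)"
    by (simp add: ml_log_ratio_def y_def a_def add_divide_distrib diff_divide_distrib add_ac add_diff_eq)
  have eq: "\<exists>\<eta>. min y (y + t * a) \<le> \<eta> \<and> \<eta> \<le> max y (y + t * a) \<and>
      ml_log_ratio \<rho> n t = - \<delta> - (t * a)\<^sup>2 / 2 * Polygamma 1 \<eta>" if pos: "y + t * a > 0"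
  proof -
    obtain \<eta> where "min y (y + t * a) \<le> \<eta>" "\<eta> \<le> max y (y + t * a)"
      "ln_Gamma (y + t * a) = ln_Gamma y + t * a * Digamma y + (t * a)\<^sup>2 / 2 * Polygamma 1 \<eta>"
      using ln_Gamma_taylor[OF ya(3) pos] by blast
    then show ?thesis
      unfolding L \<xi>(3) by (intro exI[of _ \<eta>]) (simp add: \<delta>_def algebra_simps)
  qed
  have ta: "t / \<rho> = t * a" "\<bar>t\<bar> / \<rho> = \<bar>t * a\<bar>"
    using a by (auto simp: a_def abs_mult)
  show "ml_log_ratio \<rho> n t \<le> \<bar>t\<bar> / (\<rho> * real n) - (t / \<rho>)\<^sup>2 / 2 / (y + \<bar>t\<bar> / \<rho>)"
    if "y + t / \<rho> > 0"
  proof -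
    from eq that obtain \<eta> where \<eta>: "min y (y + t * a) \<le> \<eta>" "\<eta> \<le> max y (y + t * a)"
      "ml_log_ratio \<rho> n t = - \<delta> - (t * a)\<^sup>2 / 2 * Polygamma 1 \<eta>" unfolding ta by blast
    have "\<eta> > 0" "\<eta> \<le> y + \<bar>t * a\<bar>" using \<eta> that ya unfolding ta by auto
    then have "1 / (y + \<bar>t * a\<bar>) \<le> 1 / \<eta>" by (intro divide_left_mono) auto
    also have "\<dots> \<le> Polygamma 1 \<eta>" using \<open>\<eta> > 0\<close> by (rule trigamma_bounds)
    finally have "(t * a)\<^sup>2 / 2 * (1 / (y + \<bar>t * a\<bar>)) \<le> (t * a)\<^sup>2 / 2 * Polygamma 1 \<eta>"
      by (rule mult_left_mono) auto
    then show ?thesis unfolding \<eta>(3) ta using \<delta> by simp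
  qed
  show "- (\<bar>t\<bar> / (\<rho> * real n)) - (t / \<rho>)\<^sup>2 / 2 * (1 / (y - \<bar>t\<bar> / \<rho>) + 1 / (y - \<bar>t\<bar> / \<rho>)\<^sup>2)
        \<le> ml_log_ratio \<rho> n t" if "\<bar>t\<bar> / \<rho> < y"
  proof -
    have pos: "y + t * a > 0" "y - \<bar>t * a\<bar> > 0" using that unfolding ta by auto
    from eq[OF pos(1)] obtain \<eta> where \<eta>: "min y (y + t * a) \<le> \<eta>" "\<eta> \<le> max y (y + t * a)"
      "ml_log_ratio \<rho> n t = - \<delta> - (t * a)\<^sup>2 / 2 * Polygamma 1 \<eta>" by blast
    have \<eta>': "y - \<bar>t * a\<bar> \<le> \<eta>" "\<eta> > 0" using \<eta> pos by auto
    have "Polygamma 1 \<eta> \<le> 1 / \<eta> + 1 / \<eta>\<^sup>2" using \<eta>'(2) by (rule trigamma_bounds)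
    also have "\<dots> \<le> 1 / (y - \<bar>t * a\<bar>) + 1 / (y - \<bar>t * a\<bar>)\<^sup>2"
      using \<eta>' pos by (intro add_mono divide_left_mono power_mono) auto
    finally have "(t * a)\<^sup>2 / 2 * Polygamma 1 \<eta>
        \<le> (t * a)\<^sup>2 / 2 * (1 / (y - \<bar>t * a\<bar>) + 1 / (y - \<bar>t * a\<bar>)\<^sup>2)"
      by (rule mult_left_mono) auto
    then show ?thesis unfolding \<eta>(3) ta using \<delta> by linarith
  qed
qed

text \<open>Factoring n/\<rho> out of y \<plusminus> |t|/\<rho> expresses everything in the scaled
  variable X. When p and q tend to 0 and X converges, both bounds have the limit of -X^2/4.\<close>

lemma ml_log_ratio_scaled_bounds:
  fixes \<rho> t :: real and n :: nat
  assumes "\<rho> > 1" "n > 0"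
  defines "p \<equiv> \<rho> / real n" and "q \<equiv> \<bar>t\<bar> / real n" and "X \<equiv> sqrt (2 / (\<rho> * real n)) * t"
  shows "real n + t \<ge> 0 \<Longrightarrow> ml_log_ratio \<rho> n t \<le> q / \<rho> - X\<^sup>2 / 4 / (p + 1 + q)"
    and "q < p + 1 \<Longrightarrow>
      - (q / \<rho>) - X\<^sup>2 / 4 * (1 / (p + 1 - q) + p / (p + 1 - q)\<^sup>2) \<le> ml_log_ratio \<rho> n t"
proof -
  have pos: "\<rho> > 0" "real n > 0" using assms by auto
  have X: "(t / \<rho>)\<^sup>2 / 2 = real n / \<rho> * (X\<^sup>2 / 4)"
    using pos by (simp add: X_def power_mult_distrib power_divide field_simps power2_eq_square)
  have plus: "1 + real n / \<rho> + \<bar>t\<bar> / \<rho> = real n / \<rho> * (p + 1 + q)"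
    and minus: "1 + real n / \<rho> - \<bar>t\<bar> / \<rho> = real n / \<rho> * (p + 1 - q)"
    using pos by (auto simp: p_def q_def field_simps)
  have q: "\<bar>t\<bar> / (\<rho> * real n) = q / \<rho>" by (simp add: q_def)
  have np: "real n / \<rho> \<noteq> 0" "real n / \<rho> = 1 / p" using pos by (auto simp: p_def)
  note B = ml_log_ratio_bounds[OF assms(1,2), of t]
  show "ml_log_ratio \<rho> n t \<le> q / \<rho> - X\<^sup>2 / 4 / (p + 1 + q)" if "real n + t \<ge> 0"
  proof -
    have "0 \<le> (real n + t) / \<rho>" using that pos by simp
    then have "1 + real n / \<rho> + t / \<rho> > 0" by (simp add: add_divide_distrib)
    from B(1)[OF this] show ?thesis unfolding X q plus using np(1) by simp
  qed
  show "- (q / \<rho>) - X\<^sup>2 / 4 * (1 / (p + 1 - q) + p / (p + 1 - q)\<^sup>2) \<le> ml_log_ratio \<rho> n t"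
    if "q < p + 1"
  proof -
    have "0 < real n / \<rho> * (p + 1 - q)" using that pos by simp
    then have "\<bar>t\<bar> / \<rho> < 1 + real n / \<rho>" using minus by linarith
    from B(2)[OF this] have "- (q / \<rho>) - real n / \<rho> * (X\<^sup>2 / 4) *
        (1 / (real n / \<rho> * (p + 1 - q)) + 1 / (real n / \<rho> * (p + 1 - q))\<^sup>2) \<le> ml_log_ratio \<rho> n t"
      unfolding X q minus .
    also have "real n / \<rho> * (X\<^sup>2 / 4) *
        (1 / (real n / \<rho> * (p + 1 - q)) + 1 / (real n / \<rho> * (p + 1 - q))\<^sup>2)
        = X\<^sup>2 / 4 * (1 / (p + 1 - q) + p / (p + 1 - q)\<^sup>2)"
    proof -
      have "p \<noteq> 0" "p + 1 - q \<noteq> 0" using pos that by (auto simp: p_def)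
      then show ?thesis unfolding np(2)
        by (simp add: power_divide power_mult_distrib distrib_left power2_eq_square)
    qed
    finally show ?thesis by simp
  qed
qed

text \<open>A sandwich between the two scaled bounds. The indices form an arbitrary sequence
  \<open>m\<close> tending to infinity, as needed for continuous convergence.\<close>

lemma ml_log_ratio_tendsto:
  fixes \<rho> x :: real and m :: "nat \<Rightarrow> nat" and t :: "nat \<Rightarrow> real"
  assumes "\<rho> > 1" and m: "filterlim m at_top sequentially"
    and t: "(\<lambda>i. sqrt (2 / (\<rho> * real (m i))) * t i) \<longlonglongrightarrow> x"
  shows "(\<lambda>i. ml_log_ratio \<rho> (m i) (t i)) \<longlonglongrightarrow> - (x\<^sup>2 / 4)"
proof -
  define X where "X = (\<lambda>i. sqrt (2 / (\<rho> * real (m i))) * t i)"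
  define p where "p = (\<lambda>i. \<rho> / real (m i))"
  define q where "q = (\<lambda>i. \<bar>t i\<bar> / real (m i))"
  have lim: "(\<lambda>i. f (real (m i))) \<longlonglongrightarrow> 0" if "(f \<longlongrightarrow> 0) at_top" for f :: "real \<Rightarrow> real"
    by (rule filterlim_compose[OF that])
       (rule filterlim_compose[OF filterlim_real_sequentially m])
  have pos: "\<forall>\<^sub>F i in sequentially. m i > 0"
    by (rule eventually_compose_filterlim[OF eventually_gt_at_top m])
  have X: "X \<longlonglongrightarrow> x" using t by (simp add: X_def)
  have p: "p \<longlonglongrightarrow> 0"
    unfolding p_def by (rule lim) (use assms(1) in real_asymp)
  \<comment> \<open>This product equals \<open>q\<close>: t is of the order of the square root of m,
    so |t|/m vanishes in the limit.\<close>
  have "(\<lambda>i. \<bar>X i\<bar> * sqrt (\<rho> / (2 * real (m i)))) \<longlonglongrightarrow> \<bar>x\<bar> * 0"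
    by (intro tendsto_mult tendsto_rabs X lim) (use assms(1) in real_asymp)
  moreover have "\<forall>\<^sub>F i in sequentially. \<bar>X i\<bar> * sqrt (\<rho> / (2 * real (m i))) = q i"
    using pos
  proof eventually_elim
    case (elim i)
    have "sqrt (2 / (\<rho> * real (m i))) * sqrt (\<rho> / (2 * real (m i))) = sqrt ((1 / real (m i))\<^sup>2)"
      unfolding real_sqrt_mult[symmetric] using elim assms(1)
      by (intro arg_cong[of _ _ sqrt]) (simp add: field_simps power2_eq_square)
    then have "sqrt (2 / (\<rho> * real (m i))) * sqrt (\<rho> / (2 * real (m i))) = 1 / real (m i)"
      by simp
    then have "\<bar>t i\<bar> * (sqrt (2 / (\<rho> * real (m i))) * sqrt (\<rho> / (2 * real (m i)))) = \<bar>t i\<bar> * (1 / real (m i))"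
      by simp
    then show ?case
      using assms(1) by (simp add: X_def q_def abs_mult mult_ac)
  qed
  ultimately have q: "q \<longlonglongrightarrow> 0"
    by (simp add: tendsto_cong)
  have q_less: "\<forall>\<^sub>F i in sequentially. q i < 1"
    using q by (rule order_tendstoD) simp
  show ?thesis
  proof (rule tendsto_sandwich)
    show "\<forall>\<^sub>F i in sequentially.
        - (q i / \<rho>) - (X i)\<^sup>2 / 4 * (1 / (p i + 1 - q i) + p i / (p i + 1 - q i)\<^sup>2)
        \<le> ml_log_ratio \<rho> (m i) (t i)"
      using pos q_less
    proof eventually_elim
      case (elim i)
      have "p i \<ge> 0" using assms(1) by (simp add: p_def)
      then show ?case
        using ml_log_ratio_scaled_bounds(2)[OF assms(1) elim(1), of "t i"] elim(2)
        unfolding p_def q_def X_def by linarith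
    qed
    show "\<forall>\<^sub>F i in sequentially.
        ml_log_ratio \<rho> (m i) (t i) \<le> q i / \<rho> - (X i)\<^sup>2 / 4 / (p i + 1 + q i)"
      using pos q_less
    proof eventually_elim
      case (elim i)
      then have "real (m i) + t i \<ge> 0" by (simp add: q_def)
      then show ?case
        using ml_log_ratio_scaled_bounds(1)[OF assms(1) elim(1), of "t i"]
        unfolding p_def q_def X_def by linarith
    qed
    have "(\<lambda>i. - (q i / \<rho>) - (X i)\<^sup>2 / 4 * (1 / (p i + 1 - q i) + p i / (p i + 1 - q i)\<^sup>2))
      \<longlonglongrightarrow> - (0 / \<rho>) - x\<^sup>2 / 4 * (1 / (0 + 1 - 0) + 0 / (0 + 1 - 0)\<^sup>2)"
      using assms(1) by (intro tendsto_intros p q X) auto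
    then show "(\<lambda>i. - (q i / \<rho>) - (X i)\<^sup>2 / 4 * (1 / (p i + 1 - q i) + p i / (p i + 1 - q i)\<^sup>2))
      \<longlonglongrightarrow> - (x\<^sup>2 / 4)" by simp
    have "(\<lambda>i. q i / \<rho> - (X i)\<^sup>2 / 4 / (p i + 1 + q i)) \<longlonglongrightarrow> 0 / \<rho> - x\<^sup>2 / 4 / (0 + 1 + 0)"
      using assms(1) by (intro tendsto_intros p q X) auto
    then show "(\<lambda>i. q i / \<rho> - (X i)\<^sup>2 / 4 / (p i + 1 + q i)) \<longlonglongrightarrow> - (x\<^sup>2 / 4)" by simp
  qed
qed

text \<open>The decay rate \<open>c - 1\<close> is arbitrary, so that it beats the growth of
  \<open>\<bar>1 + h \<zeta>\<bar>\<^sup>t\<close> for \<open>\<zeta>\<close> in any bounded set.\<close>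

lemma ml_log_ratio_le:
  fixes \<rho> c t :: real and n :: nat
  defines "h \<equiv> sqrt (2 / (\<rho> * real n))"
  assumes "\<rho> > 1" "real n \<ge> \<rho>" "c \<ge> 0" "4 * c * \<rho> * h \<le> 1" "real n + t \<ge> 0"
  shows "ml_log_ratio \<rho> n t \<le> 16 * c\<^sup>2 - (c - 1) * (h * \<bar>t\<bar>)"
proof -
  define X where "X = h * \<bar>t\<bar>"
  have n: "n > 0" "real n > 0" using assms(2,3) by (auto intro: gr0I)
  have h: "h > 0" using n assms(2) by (simp add: h_def)
  have h2: "h\<^sup>2 = 2 / (\<rho> * real n)" using n assms(2) by (simp add: h_def)
  have "1 * 1 \<le> \<rho> * real n" using assms(2,3) by (intro mult_mono) auto
  then have "h\<^sup>2 \<le> 2\<^sup>2" unfolding h2 using n assms(2) by (simp add: field_simps)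
  then have hle: "h \<le> 2" by (rule power2_le_imp_le) simp
  have X: "X \<ge> 0" using h by (simp add: X_def)
  have q: "\<bar>t\<bar> / real n = X * \<rho> * h / 2"
  proof -
    have "X * \<rho> * h / 2 = \<bar>t\<bar> * \<rho> * h\<^sup>2 / 2" by (simp add: X_def power2_eq_square)
    also have "\<dots> = \<bar>t\<bar> / real n" unfolding h2 using n assms(2) by simp
    finally show ?thesis by simp
  qed
  have "ml_log_ratio \<rho> n t \<le> X * \<rho> * h / 2 / \<rho> - (h * t)\<^sup>2 / 4 / (\<rho> / real n + 1 + X * \<rho> * h / 2)"
    using ml_log_ratio_scaled_bounds(1)[OF assms(2) n(1) assms(6)] unfolding q h_def[symmetric] .
  moreover have "(h * t)\<^sup>2 = X\<^sup>2" by (simp add: X_def power_mult_distrib)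
  \<comment> \<open>The linear error costs at most X, since h \<le> 2; this turns the rate c into c
    - 1.\<close>
  moreover have "X * \<rho> * h / 2 / \<rho> \<le> X"
  proof -
    have "X * (h / 2) \<le> X * 1" using X hle by (intro mult_left_mono) auto
    then show ?thesis using assms(2) by simp
  qed
  moreover have "c * X - 16 * c\<^sup>2 \<le> X\<^sup>2 / 4 / (\<rho> / real n + 1 + X * \<rho> * h / 2)"
  proof -
    have D: "\<rho> / real n \<le> 1" "0 \<le> \<rho> / real n" "0 \<le> X * \<rho> * h / 2"
      using assms(2,3) n X h by auto
    have "c * X - 16 * c\<^sup>2 \<le> X\<^sup>2 / 4 / (2 + X * \<rho> * h / 2)"
    \<comment> \<open>For X \<le> 16c the left side is not positive. Beyond that, X^2/4 splits into
      two halves: one dominates 2cX because X > 16c, the other dominates cX * X\<rho>h/2 because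
      4c\<rho>h \<le> 1.\<close>
    proof (cases "X \<le> 16 * c")
      case True
      then have "c * X \<le> c * (16 * c)" using assms(4) by (intro mult_left_mono) auto
      then have "c * X - 16 * c\<^sup>2 \<le> 0" by (simp add: power2_eq_square)
      also have "0 \<le> X\<^sup>2 / 4 / (2 + X * \<rho> * h / 2)" using D by simp
      finally show ?thesis .
    next
      case False
      then have "X * (16 * c) \<le> X * X" using X by (intro mult_left_mono) auto
      moreover have "X\<^sup>2 * (4 * c * \<rho> * h) \<le> X\<^sup>2 * 1"
        using assms(5) by (intro mult_left_mono) auto
      ultimately have "(c * X) * (2 + X * \<rho> * h / 2) \<le> X\<^sup>2 / 4"
        by (simp add: power2_eq_square algebra_simps)
      then have "c * X \<le> X\<^sup>2 / 4 / (2 + X * \<rho> * h / 2)"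
        using D by (subst pos_le_divide_eq) auto
      then show ?thesis using zero_le_power2[of c] by linarith
    qed
    also have "\<dots> \<le> X\<^sup>2 / 4 / (\<rho> / real n + 1 + X * \<rho> * h / 2)"
      using D by (intro divide_left_mono) (auto intro!: mult_pos_pos add_nonneg_pos add_pos_nonneg)
    finally show ?thesis .
  qed
  ultimately have "ml_log_ratio \<rho> n t \<le> X - (c * X - 16 * c\<^sup>2)" by simp
  then show ?thesis by (simp add: X_def algebra_simps)
qed

section \<open>Riemann sums and continuous convergence\<close>

text \<open>Failure of uniformity yields indices tending to infinity and points of K with error at
  least e. Along a subsequence the points converge in K, and then both f and l have limit l(z0), a
  contradiction. It reduces the theorem to limits along sequences.\<close>

lemma uniform_limit_compactI:
  fixes f :: "nat \<Rightarrow> 'a::metric_space \<Rightarrow> 'b::metric_space"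
  assumes K: "compact K" and l: "continuous_on K l"
    and lim: "\<And>m z z0. filterlim m at_top sequentially \<Longrightarrow> (\<And>i. z i \<in> K) \<Longrightarrow> z0 \<in> K \<Longrightarrow>
      z \<longlonglongrightarrow> z0 \<Longrightarrow> (\<lambda>i. f (m i) (z i)) \<longlonglongrightarrow> l z0"
  shows "uniform_limit K f l sequentially"
proof (rule ccontr)
  assume "\<not> uniform_limit K f l sequentially"
  then obtain e where e: "e > 0" "\<forall>N. \<exists>n\<ge>N. \<exists>x\<in>K. e \<le> dist (f n x) (l x)"
    unfolding uniform_limit_sequentially_iff by (auto simp: not_less)
  then obtain m z where mz: "\<And>N. m N \<ge> N" "\<And>N. z N \<in> K" "\<And>N. e \<le> dist (f (m N) (z N)) (l (z N))"
    by metis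
  from K mz(2) obtain z0 r where r: "z0 \<in> K" "strict_mono r" "(z \<circ> r) \<longlonglongrightarrow> z0"
    unfolding compact_def by blast
  have m: "filterlim (m \<circ> r) at_top sequentially"
  proof (rule filterlim_at_top_mono)
    show "filterlim r at_top sequentially" using r(2) by (rule filterlim_subseq)
    show "\<forall>\<^sub>F i in sequentially. r i \<le> (m \<circ> r) i" using mz(1) by simp
  qed
  have "(\<lambda>i. f ((m \<circ> r) i) ((z \<circ> r) i)) \<longlonglongrightarrow> l z0"
    using m r mz(2) by (intro lim) (auto simp: comp_def)
  moreover have "(\<lambda>i. l ((z \<circ> r) i)) \<longlonglongrightarrow> l z0"
    using l r mz(2) unfolding continuous_on_sequentially by (auto simp: comp_def)
  ultimately have "(\<lambda>i. dist (f ((m \<circ> r) i) ((z \<circ> r) i)) (l ((z \<circ> r) i))) \<longlonglongrightarrow> dist (l z0) (l z0)"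
    by (rule tendsto_dist)
  then have "\<forall>\<^sub>F i in sequentially. dist (f ((m \<circ> r) i) ((z \<circ> r) i)) (l ((z \<circ> r) i)) < e"
    using e(1) by (intro order_tendstoD) auto
  then show False using mz(3) by (auto simp: eventually_sequentially not_less[symmetric])
qed

text \<open>Writes h times a series as the integral of a step function, which opens the way to
  dominated convergence. The function is a sum over cells of length h, and absolute summability
  allows exchanging sum and integral.\<close>

lemma step_function_integral:
  fixes f :: "nat \<Rightarrow> complex" and h :: real
  assumes h: "h > 0" and f: "summable (\<lambda>k. norm (f k))"
  shows "(\<integral>x. indicator {0..} x *\<^sub>R f (nat \<lfloor>x / h\<rfloor>) \<partial>lborel) = of_real h * (\<Sum>k. f k)"
proof -
  define s where "s = (\<lambda>k x. indicator {h * real k..<h * real (Suc k)} x *\<^sub>R f k)"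
  \<comment> \<open>At each x at most one cell contributes, so the pointwise series has at most one
    nonzero term.\<close>
  have s_eq: "s k x = (if k = nat \<lfloor>x / h\<rfloor> then indicator {0..} x *\<^sub>R f (nat \<lfloor>x / h\<rfloor>) else 0)" for k x
  proof (cases "x \<ge> 0")
    case True
    have "x \<in> {h * real k..<h * real (Suc k)} \<longleftrightarrow> real k \<le> x / h \<and> x / h < real k + 1"
      using h by (auto simp: field_simps)
    also have "\<dots> \<longleftrightarrow> \<lfloor>x / h\<rfloor> = int k"
      by (auto simp: floor_eq_iff)
    also have "\<dots> \<longleftrightarrow> k = nat \<lfloor>x / h\<rfloor>" using True h by auto
    finally show ?thesis using True by (auto simp: s_def indicator_def)
  next
    case False
    then have "\<not> h * real k \<le> x" using h by (smt (verit) mult_nonneg_nonneg of_nat_0_le_iff)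
    then show ?thesis using False by (simp add: s_def)
  qed
  have sums: "(\<lambda>k. s k x) sums (indicator {0..} x *\<^sub>R f (nat \<lfloor>x / h\<rfloor>))" for x
    unfolding s_eq by (rule sums_single)
  have int: "integrable lborel (s k)" "integral\<^sup>L lborel (s k) = h * f k"
    for k
    using h by (auto simp: s_def algebra_simps scaleR_conv_of_real)
  have int_norm: "integral\<^sup>L lborel (\<lambda>x. norm (s k x)) = h * norm (f k)" for k
  proof -
    have "(\<lambda>x. norm (s k x)) = (\<lambda>x. indicator {h * real k..<h * real (Suc k)} x *\<^sub>R norm (f k))"
      by (auto simp: s_def)
    then show ?thesis using h by (simp add: algebra_simps)
  qed
  have "summable (\<lambda>k. norm (s k x))" for x
    unfolding s_eq by (rule summable_finite[of "{nat \<lfloor>x / h\<rfloor>}"]) auto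
  moreover have "summable (\<lambda>k. \<integral>x. norm (s k x) \<partial>lborel)"
    unfolding int_norm by (rule summable_mult[OF f])
  ultimately have "(\<integral>x. (\<Sum>k. s k x) \<partial>lborel) = (\<Sum>k. integral\<^sup>L lborel (s k))"
    by (intro integral_suminf int) auto
  also have "(\<lambda>x. \<Sum>k. s k x) = (\<lambda>x. indicator {0..} x *\<^sub>R f (nat \<lfloor>x / h\<rfloor>))"
    using sums by (simp add: sums_iff)
  also have "(\<Sum>k. integral\<^sup>L lborel (s k)) = h * (\<Sum>k. f k)"
    unfolding int using f summable_norm_cancel by (intro suminf_mult) blast
  finally show ?thesis .
qed

lemma summable_exp_mesh:
  fixes h :: real
  assumes "h > 0"
  shows "summable (\<lambda>k. exp (- (h * real k)))"
proof -
  have "(\<lambda>k. exp (- (h * real k))) = (\<lambda>k. exp (- h) ^ k)"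
    by (simp add: exp_of_nat_mult[symmetric] mult_ac)
  then show ?thesis using assms by (simp add: summable_geometric)
qed

text \<open>Dominated convergence for the step functions with value f i (floor(x / h i)). Pointwise
  convergence is demanded along every index sequence with h k tending to x, since the grid point
  just below x is such a sequence. Integrability of the limit is obtained as part of the
  conclusion.\<close>

lemma riemann_sums_dominated:
  fixes f :: "nat \<Rightarrow> nat \<Rightarrow> complex" and h :: "nat \<Rightarrow> real" and g :: "real \<Rightarrow> complex"
  assumes h: "h \<longlonglongrightarrow> 0" "\<forall>\<^sub>F i in sequentially. h i > 0"
    and bound: "\<forall>\<^sub>F i in sequentially. \<forall>k. norm (f i k) \<le> C * exp (- (h i * real k))"
    and lim: "\<And>x k. (\<lambda>i. h i * real (k i)) \<longlonglongrightarrow> x \<Longrightarrow> (\<lambda>i. f i (k i)) \<longlonglongrightarrow> g x"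
    and g: "g \<in> borel_measurable borel"
  shows "integrable lborel (\<lambda>x. indicator {0..} x *\<^sub>R g x)"
    and "(\<lambda>i. of_real (h i) * (\<Sum>k. f i k)) \<longlonglongrightarrow> (\<integral>x. indicator {0..} x *\<^sub>R g x \<partial>lborel)"
proof -
  have "\<forall>\<^sub>F i in sequentially. h i < 1" using h(1) by (rule order_tendstoD) simp
  with h(2) bound have "\<forall>\<^sub>F i in sequentially. h i > 0 \<and> h i < 1 \<and>
      (\<forall>k. norm (f i k) \<le> C * exp (- (h i * real k)))"
    by eventually_elim auto
  then obtain N where "\<And>i. i \<ge> N \<Longrightarrow> h i > 0 \<and> h i < 1 \<and>
      (\<forall>k. norm (f i k) \<le> C * exp (- (h i * real k)))"
    by (auto simp: eventually_sequentially)
  \<comment> \<open>Shifting by N makes the eventual bounds valid for every index; the shift is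
    undone at the end.\<close>
  then have N: "\<And>i. h (i + N) > 0" "\<And>i. h (i + N) < 1"
      "\<And>i k. norm (f (i + N) k) \<le> C * exp (- (h (i + N) * real k))"
    by auto
  have C: "C \<ge> 0" using order_trans[OF norm_ge_zero N(3)[of 0 0]] by simp
  have smm: "summable (\<lambda>k. norm (f (i + N) k))" for i
    by (rule summable_comparison_test'[OF summable_mult[OF summable_exp_mesh[OF N(1)]]])
       (use N(3) in auto)
  define S where "S = (\<lambda>i x. indicator {0..} x *\<^sub>R f (i + N) (nat \<lfloor>x / h (i + N)\<rfloor>))"
  \<comment> \<open>The grid point lies above x - h > x - 1, so exp(-hk) is at most e * exp(-x). The
    factor \<open>x ^ 0\<close> only matches the form of the known integral.\<close>
  define w where "w = (\<lambda>x::real. C * exp 1 * (x ^ 0 * exp (- x) * indicator {0..} x))"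
  have meas: "(\<lambda>x. indicator {0..} x *\<^sub>R g x) \<in> borel_measurable lborel"
    using g by measurable
  have S_meas: "S i \<in> borel_measurable lborel" for i
    unfolding S_def by measurable
  have w: "integrable lborel w"
    unfolding w_def using has_bochner_integral_I0i_power_exp_m'[of 0]
    by (intro integrable_mult_right) (simp add: has_bochner_integral_iff)
  have mesh: "x - h (i + N) \<le> h (i + N) * real (nat \<lfloor>x / h (i + N)\<rfloor>)"
      "h (i + N) * real (nat \<lfloor>x / h (i + N)\<rfloor>) \<le> x" if "x \<ge> 0" for x i
  proof -
    have "real (nat \<lfloor>x / h (i + N)\<rfloor>) = \<lfloor>x / h (i + N)\<rfloor>"
      using N(1)[of i] that by simp
    then have "x / h (i + N) - 1 \<le> real (nat \<lfloor>x / h (i + N)\<rfloor>)"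
      "real (nat \<lfloor>x / h (i + N)\<rfloor>) \<le> x / h (i + N)"
      by linarith+
    from this[THEN mult_left_mono, of "h (i + N)"] N(1)[of i]
    show "x - h (i + N) \<le> h (i + N) * real (nat \<lfloor>x / h (i + N)\<rfloor>)"
      "h (i + N) * real (nat \<lfloor>x / h (i + N)\<rfloor>) \<le> x"
      by (auto simp: right_diff_distrib)
  qed
  have dom: "norm (S i x) \<le> w x" for i x
  proof (cases "x \<ge> 0")
    case True
    have "norm (S i x) \<le> C * exp (- (h (i + N) * real (nat \<lfloor>x / h (i + N)\<rfloor>)))"
      using True N(3) by (simp add: S_def)
    also have "\<dots> \<le> C * exp (1 - x)"
      using mesh(1)[OF True, of i] N(2)[of i] C by (intro mult_left_mono) auto
    also have "\<dots> = w x" using True by (simp add: w_def exp_diff exp_minus field_simps)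
    finally show ?thesis .
  qed (simp add: S_def w_def)
  have conv: "(\<lambda>i. S i x) \<longlonglongrightarrow> indicator {0..} x *\<^sub>R g x" for x
  proof (cases "x \<ge> 0")
    case True
    define k where "k = (\<lambda>i. nat \<lfloor>x / h i\<rfloor>)"
    have "(\<lambda>i. h (i + N) * real (k (i + N))) \<longlonglongrightarrow> x"
    proof (rule tendsto_sandwich)
      show "\<forall>\<^sub>F i in sequentially. x - h (i + N) \<le> h (i + N) * real (k (i + N))"
        "\<forall>\<^sub>F i in sequentially. h (i + N) * real (k (i + N)) \<le> x"
        using mesh[OF True] by (auto simp: k_def)
      have "(\<lambda>i. x - h (i + N)) \<longlonglongrightarrow> x - 0"
        by (intro tendsto_intros LIMSEQ_ignore_initial_segment h)
      then show "(\<lambda>i. x - h (i + N)) \<longlonglongrightarrow> x" by simp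
    qed auto
    then have "(\<lambda>i. h i * real (k i)) \<longlonglongrightarrow> x" by (rule LIMSEQ_offset)
    from LIMSEQ_ignore_initial_segment[OF lim[OF this], of N] show ?thesis
      using True by (simp add: S_def k_def)
  qed (simp add: S_def)
  note dct = meas S_meas w AE_I2[OF conv] AE_I2[OF dom]
  show "integrable lborel (\<lambda>x. indicator {0..} x *\<^sub>R g x)"
    by (rule integrable_dominated_convergence[OF dct])
  have "(\<lambda>i. integral\<^sup>L lborel (S i)) \<longlonglongrightarrow> (\<integral>x. indicator {0..} x *\<^sub>R g x \<partial>lborel)"
    by (rule integral_dominated_convergence[OF dct])
  then have "(\<lambda>i. of_real (h (i + N)) * (\<Sum>k. f (i + N) k)) \<longlonglongrightarrow> (\<integral>x. indicator {0..} x *\<^sub>R g x \<partial>lborel)"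
    unfolding S_def step_function_integral[OF N(1) smm] .
  then show "(\<lambda>i. of_real (h i) * (\<Sum>k. f i k)) \<longlonglongrightarrow> (\<integral>x. indicator {0..} x *\<^sub>R g x \<partial>lborel)"
    by (rule LIMSEQ_offset)
qed

section \<open>The complementary error function as a Gaussian integral\<close>

text \<open>On [0,T] this is the fundamental theorem of calculus; integrability on the half-line
  lets T tend to infinity by dominated convergence.\<close>

lemma half_line_integral_FTC:
  fixes f F :: "real \<Rightarrow> complex"
  assumes F: "\<And>x. (F has_vector_derivative f x) (at x)"
    and f: "continuous_on UNIV f"
    and int: "integrable lborel (\<lambda>x. indicator {0..} x *\<^sub>R f x)"
  shows "((\<lambda>T. F T - F 0) \<longlongrightarrow> (\<integral>x. indicator {0..} x *\<^sub>R f x \<partial>lborel)) at_top"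
proof -
  have [measurable]: "f \<in> borel_measurable borel"
    using f by (rule borel_measurable_continuous_onI)
  have "((\<lambda>T. \<integral>x. indicator {0..T} x *\<^sub>R f x \<partial>lborel)
      \<longlongrightarrow> (\<integral>x. indicator {0..} x *\<^sub>R f x \<partial>lborel)) at_top"
  proof (rule integral_dominated_convergence_at_top)
    show "integrable lborel (\<lambda>x. norm (indicator {0..} x *\<^sub>R f x))"
      using int by (rule integrable_norm)
    show "AE x in lborel. ((\<lambda>T. indicator {0..T} x *\<^sub>R f x) \<longlongrightarrow> indicator {0..} x *\<^sub>R f x) at_top"
    proof (rule AE_I2)
      fix x :: real
      have "\<forall>\<^sub>F T in at_top. indicator {0..} x *\<^sub>R f x = indicator {0..T} x *\<^sub>R f x"
        using eventually_ge_at_top[of x] by eventually_elim (auto simp: indicator_def)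
      then show "((\<lambda>T. indicator {0..T} x *\<^sub>R f x) \<longlongrightarrow> indicator {0..} x *\<^sub>R f x) at_top"
        by (rule Lim_transform_eventually[OF tendsto_const])
    qed
    show "\<forall>\<^sub>F T in at_top. AE x in lborel.
        norm (indicator {0..T} x *\<^sub>R f x) \<le> norm (indicator {0..} x *\<^sub>R f x)"
      by (intro always_eventually allI AE_I2) (auto simp: indicator_def)
  qed measurable
  moreover have "\<forall>\<^sub>F T in at_top. (\<integral>x. indicator {0..T} x *\<^sub>R f x \<partial>lborel) = F T - F 0"
    using eventually_ge_at_top[of 0]
  proof eventually_elim
    case (elim T)
    show ?case
      using F f elim
      by (intro integral_FTC_Icc) (auto intro: has_vector_derivative_at_within continuous_on_subset)
  qed
  ultimately show ?thesis by (rule Lim_transform_eventually)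
qed

text \<open>The integrand is entire and the plane convex, so a global primitive exists. This gives
  the continuity of \<open>erfc\<close> and access to integrals by differences.\<close>

lemma erfc_primitive:
  obtains \<Phi> where "\<And>z. (\<Phi> has_field_derivative exp (- z\<^sup>2)) (at z)"
    and "\<And>z. erfc z = 1 - 2 / of_real (sqrt pi) * (\<Phi> z - \<Phi> 0)"
proof -
  have hol: "(\<lambda>z::complex. exp (- z\<^sup>2)) holomorphic_on UNIV"
    by (intro holomorphic_intros)
  obtain \<Phi> :: "complex \<Rightarrow> complex" where \<Phi>: "\<And>z. (\<Phi> has_field_derivative exp (- z\<^sup>2)) (at z)"
    using holomorphic_convex_primitive'[OF convex_UNIV open_UNIV hol] by auto
  have "contour_integral (linepath 0 z) (\<lambda>v. exp (- v\<^sup>2)) = \<Phi> z - \<Phi> 0" for z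
    using contour_integral_primitive[of UNIV \<Phi> "\<lambda>z. exp (- z\<^sup>2)" "linepath 0 z"] \<Phi>
    by (intro contour_integral_unique) auto
  then show ?thesis using that[of \<Phi>] \<Phi> by (simp add: erfc_def)
qed

text \<open>The integrand is even, so reversing the segment changes the sign of the
  integral.\<close>

lemma erfc_minus: "erfc (- \<zeta>) = 2 - erfc \<zeta>"
proof -
  have "contour_integral (linepath 0 (- \<zeta>)) (\<lambda>v. exp (- v\<^sup>2))
      = - contour_integral (linepath 0 \<zeta>) (\<lambda>v. exp (- v\<^sup>2))"
    unfolding contour_integral_integral vector_derivative_linepath_at by (simp add: linepath_def)
  then show ?thesis by (simp add: erfc_def)
qed

text \<open>Along the real axis this is the Gaussian integral. Displacing the endpoint by \<zeta>
  has no effect in the limit, as exp(-w^2) is uniformly small on the disc of radius |\<zeta>| about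
  T.\<close>

lemma gaussian_primitive_tendsto:
  fixes \<Phi> :: "complex \<Rightarrow> complex"
  assumes \<Phi>: "\<And>z. (\<Phi> has_field_derivative exp (- z\<^sup>2)) (at z)"
  shows "((\<lambda>T. \<Phi> (\<zeta> + of_real T) - \<Phi> 0) \<longlongrightarrow> of_real (sqrt pi / 2)) at_top"
proof -
  have G: "has_bochner_integral lborel (\<lambda>x. indicator {0..} x *\<^sub>R complex_of_real (exp (- x\<^sup>2)))
      (of_real (sqrt pi / 2))"
    using has_bochner_integral_of_real[OF gaussian_moment_0, where 'a = complex]
    by (simp add: scaleR_conv_of_real)
  have "((\<lambda>T. \<Phi> (of_real T) - \<Phi> (of_real 0))
      \<longlongrightarrow> (\<integral>x. indicator {0..} x *\<^sub>R complex_of_real (exp (- x\<^sup>2)) \<partial>lborel)) at_top"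
  proof (rule half_line_integral_FTC)
    fix x :: real
    have "((\<lambda>x. \<Phi> (of_real x)) has_vector_derivative exp (- (of_real x)\<^sup>2)) (at x)"
      using has_vector_derivative_real_field[OF \<Phi>[of "of_real x"]] by (simp add: o_def)
    then show "((\<lambda>x. \<Phi> (of_real x)) has_vector_derivative complex_of_real (exp (- x\<^sup>2))) (at x)"
      by (simp add: exp_of_real[symmetric])
  qed (use G in \<open>auto intro!: continuous_intros simp: has_bochner_integral_iff\<close>)
  then have real: "((\<lambda>T. \<Phi> (of_real T) - \<Phi> 0) \<longlongrightarrow> of_real (sqrt pi / 2)) at_top"
    by (simp only: has_bochner_integral_integral_eq[OF G] of_real_0)
  define r where "r = norm \<zeta>"
  have "((\<lambda>T. \<Phi> (\<zeta> + of_real T) - \<Phi> (of_real T)) \<longlongrightarrow> 0) at_top"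
  proof (rule Lim_null_comparison)
    show "\<forall>\<^sub>F T in at_top. norm (\<Phi> (\<zeta> + of_real T) - \<Phi> (of_real T)) \<le> exp (r\<^sup>2 - (T - r)\<^sup>2) * r"
      using eventually_ge_at_top[of r]
    proof eventually_elim
      case (elim T)
      have "norm (\<Phi> (\<zeta> + of_real T) - \<Phi> (of_real T))
          \<le> exp (r\<^sup>2 - (T - r)\<^sup>2) * norm (\<zeta> + of_real T - of_real T)"
      proof (rule field_differentiable_bound)
        show "convex (cball (complex_of_real T) r)" by simp
        show "(\<Phi> has_field_derivative exp (- w\<^sup>2)) (at w within cball (of_real T) r)" for w
          using \<Phi> by (rule has_field_derivative_at_within)
        \<comment> \<open>The modulus is exp((Im w)^2 - (Re w)^2), and on the disc |Im w| \<le> r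
          and Re w \<ge> T - r \<ge> 0.\<close>
        show "norm (exp (- w\<^sup>2)) \<le> exp (r\<^sup>2 - (T - r)\<^sup>2)" if "w \<in> cball (of_real T) r" for w :: complex
        proof -
          have w: "norm (w - of_real T) \<le> r" using that by (simp add: dist_norm norm_minus_commute)
          have "(T - r)\<^sup>2 \<le> (Re w)\<^sup>2"
            using abs_Re_le_cmod[of "w - of_real T"] w elim by (intro power_mono) auto
          moreover have "(Im w)\<^sup>2 \<le> r\<^sup>2"
            using abs_Im_le_cmod[of "w - of_real T"] w by (simp add: abs_le_square_iff[symmetric])
          moreover have "Re (w\<^sup>2) = (Re w)\<^sup>2 - (Im w)\<^sup>2" by (simp add: power2_eq_square)
          ultimately show ?thesis by simp
        qed
      qed (auto simp: r_def dist_norm)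
      then show ?case by (simp add: r_def)
    qed
    show "((\<lambda>T. exp (r\<^sup>2 - (T - r)\<^sup>2) * r) \<longlongrightarrow> 0) at_top"
      by real_asymp
  qed
  from tendsto_add[OF this real] show ?thesis by simp
qed

text \<open>Completing the square, -x^2/4 - x\<zeta> = \<zeta>^2 - (\<zeta> + x/2)^2, gives an
  explicit primitive. The integrability assumed here is later supplied by
  \<open>riemann_sums_dominated\<close>.\<close>

lemma gaussian_half_line_integral:
  assumes "integrable lborel (\<lambda>x. indicator {0..} x *\<^sub>R exp (- (of_real x)\<^sup>2 / 4 - of_real x * \<zeta>))"
  shows "(\<integral>x. indicator {0..} x *\<^sub>R exp (- (of_real x)\<^sup>2 / 4 - of_real x * \<zeta>) \<partial>lborel)
    = of_real (sqrt pi) * exp (\<zeta>\<^sup>2) * erfc \<zeta>"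
proof -
  obtain \<Phi> where \<Phi>: "\<And>z. (\<Phi> has_field_derivative exp (- z\<^sup>2)) (at z)"
    and erfc: "\<And>z. erfc z = 1 - 2 / of_real (sqrt pi) * (\<Phi> z - \<Phi> 0)"
    by (rule erfc_primitive) blast
  \<comment> \<open>The factor 2 offsets the inner derivative 1/2.\<close>
  define F where "F = (\<lambda>x::real. 2 * exp (\<zeta>\<^sup>2) * \<Phi> (\<zeta> + of_real (x / 2)))"
  have "((\<lambda>T. F T - F 0) \<longlongrightarrow>
      (\<integral>x. indicator {0..} x *\<^sub>R exp (- (of_real x)\<^sup>2 / 4 - of_real x * \<zeta>) \<partial>lborel)) at_top"
  proof (rule half_line_integral_FTC)
    fix x :: real
    have "((\<lambda>w. 2 * exp (\<zeta>\<^sup>2) * \<Phi> (\<zeta> + w / 2)) has_field_derivative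
        2 * exp (\<zeta>\<^sup>2) * (exp (- (\<zeta> + of_real x / 2)\<^sup>2) * (1 / 2))) (at (of_real x))"
      by (rule DERIV_cmult, rule DERIV_chain2[OF \<Phi>]) (auto intro!: derivative_eq_intros)
    also have "2 * exp (\<zeta>\<^sup>2) * (exp (- (\<zeta> + of_real x / 2)\<^sup>2) * (1 / 2))
        = exp (\<zeta>\<^sup>2 + - (\<zeta> + of_real x / 2)\<^sup>2)"
      unfolding exp_add by simp
    also have "\<zeta>\<^sup>2 + - (\<zeta> + of_real x / 2)\<^sup>2 = - (of_real x)\<^sup>2 / 4 - of_real x * \<zeta>"
      by (simp add: power2_eq_square field_simps)
    finally show "(F has_vector_derivative exp (- (of_real x)\<^sup>2 / 4 - of_real x * \<zeta>)) (at x)"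
      unfolding F_def using has_vector_derivative_real_field[of _ _ x UNIV] by (simp add: o_def)
  next
    show "continuous_on UNIV (\<lambda>x. exp (- (complex_of_real x)\<^sup>2 / 4 - of_real x * \<zeta>))"
      by (intro continuous_intros) auto
  qed (rule assms)
  moreover have "((\<lambda>T. F T - F 0) \<longlongrightarrow>
      2 * exp (\<zeta>\<^sup>2) * (of_real (sqrt pi / 2) - (\<Phi> \<zeta> - \<Phi> 0))) at_top"
  proof -
    have "filterlim (\<lambda>T::real. T / 2) at_top at_top" by real_asymp
    from filterlim_compose[OF gaussian_primitive_tendsto[OF \<Phi>, of \<zeta>] this]
    have "((\<lambda>T. 2 * exp (\<zeta>\<^sup>2) * ((\<Phi> (\<zeta> + of_real (T / 2)) - \<Phi> 0) - (\<Phi> \<zeta> - \<Phi> 0))) \<longlongrightarrow>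
      2 * exp (\<zeta>\<^sup>2) * (of_real (sqrt pi / 2) - (\<Phi> \<zeta> - \<Phi> 0))) at_top"
      by (intro tendsto_intros)
    then show ?thesis by (simp add: F_def algebra_simps)
  qed
  ultimately have "(\<integral>x. indicator {0..} x *\<^sub>R exp (- (of_real x)\<^sup>2 / 4 - of_real x * \<zeta>) \<partial>lborel)
      = 2 * exp (\<zeta>\<^sup>2) * (of_real (sqrt pi / 2) - (\<Phi> \<zeta> - \<Phi> 0))"
    by (rule tendsto_unique[rotated]) simp
  also have "\<dots> = of_real (sqrt pi) * exp (\<zeta>\<^sup>2) * erfc \<zeta>"
  proof -
    have "complex_of_real (sqrt pi) \<noteq> 0" by simp
    then show ?thesis unfolding erfc by (simp add: field_simps)
  qed
  finally show ?thesis .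
qed

section \<open>Powers of 1 + h\<zeta> with exponents of order 1/h\<close>

text \<open>Caratheodory's form of the derivative of Ln at 1 gives Ln w = g(w)(w - 1) with g
  continuous at 1 and g(1) = 1. Hence k Ln(1 + hz) = (hk) z g(w), which tends to x\<zeta>.\<close>

lemma one_plus_mesh_power_tendsto:
  fixes z :: "nat \<Rightarrow> complex" and h :: "nat \<Rightarrow> real"
  assumes h: "h \<longlonglongrightarrow> 0" and z: "z \<longlonglongrightarrow> \<zeta>" and k: "(\<lambda>i. h i * real (k i)) \<longlonglongrightarrow> x"
  shows "(\<lambda>i. (1 + of_real (h i) * z i) ^ k i) \<longlonglongrightarrow> exp (of_real x * \<zeta>)"
proof -
  have "(Ln has_field_derivative inverse 1) (at 1)"
    by (rule has_field_derivative_Ln) simp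
  then obtain g where g: "\<And>w. Ln w - Ln 1 = g w * (w - 1)" "isCont g 1" "g 1 = 1"
    unfolding CARAT_DERIV by auto
  define w where "w = (\<lambda>i. 1 + of_real (h i) * z i)"
  have w: "w \<longlonglongrightarrow> 1"
  proof -
    have "(\<lambda>i. 1 + of_real (h i) * z i) \<longlonglongrightarrow> 1 + of_real 0 * \<zeta>"
      by (intro tendsto_intros h z)
    then show ?thesis by (simp add: w_def)
  qed
  have gw: "(\<lambda>i. g (w i)) \<longlonglongrightarrow> 1"
    using isCont_tendsto_compose[OF g(2) w] g(3) by simp
  have "(\<lambda>i. exp (of_real (h i * real (k i)) * (z i * g (w i)))) \<longlonglongrightarrow> exp (of_real x * (\<zeta> * 1))"
    by (intro tendsto_intros gw z k)
  moreover have "\<forall>\<^sub>F i in sequentially. exp (of_real (h i * real (k i)) * (z i * g (w i))) = w i ^ k i"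
    using tendsto_imp_eventually_ne[OF w one_neq_zero]
  proof eventually_elim
    case (elim i)
    have "of_real (h i) * (z i * g (w i)) = Ln (w i)"
      using g(1)[of "w i"] by (simp add: w_def mult_ac)
    then have "of_real (h i * real (k i)) * (z i * g (w i)) = of_nat (k i) * Ln (w i)"
      by (metis mult.assoc mult.commute of_real_mult of_real_of_nat_eq)
    then show ?case using elim by (simp only: exp_of_nat_mult exp_Ln not_False_eq_True)
  qed
  ultimately show ?thesis
    unfolding w_def by (simp add: tendsto_cong)
qed

text \<open>With s = hr \<le> 1/2, the modulus of 1 + h\<zeta> lies between 1 - s and 1 + s, and
  ln(1 - s) \<ge> -s - 2s^2 \<ge> -2s. The common rate 2r serves sections and tails alike.\<close>

lemma one_plus_mesh_power_le:
  fixes \<zeta> :: complex and h r :: real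
  assumes "norm \<zeta> \<le> r" "0 \<le> h" "h * r \<le> 1 / 2"
  shows "norm ((1 + of_real h * \<zeta>) ^ k) \<le> exp (2 * r * (h * real k))"
    and "norm (inverse (1 + of_real h * \<zeta>) ^ k) \<le> exp (2 * r * (h * real k))"
    and "1 + of_real h * \<zeta> \<noteq> 0"
proof -
  have r: "0 \<le> r" using order_trans[OF norm_ge_zero assms(1)] .
  have hz: "norm (of_real h * \<zeta>) \<le> h * r" "0 \<le> h * r"
    using assms(1,2) r by (auto simp: norm_mult intro!: mult_left_mono)
  have exp_k: "exp (2 * (h * r)) ^ k = exp (2 * r * (h * real k))"
    by (simp add: exp_of_nat_mult[symmetric] mult_ac)
  have "norm (1 + of_real h * \<zeta>) \<le> 1 + 2 * (h * r)"
    using norm_triangle_ineq[of 1 "of_real h * \<zeta>"] hz by simp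
  also have "\<dots> \<le> exp (2 * (h * r))" by (rule exp_ge_add_one_self)
  finally show "norm ((1 + of_real h * \<zeta>) ^ k) \<le> exp (2 * r * (h * real k))"
    unfolding norm_power exp_k[symmetric] by (intro power_mono) auto
  have "- (h * r) - 2 * (h * r)\<^sup>2 \<le> ln (1 - h * r)"
    using hz assms(3) by (intro ln_one_minus_pos_lower_bound) auto
  moreover have "2 * (h * r)\<^sup>2 \<le> h * r"
    using mult_right_mono[OF assms(3) hz(2)] by (simp add: power2_eq_square)
  ultimately have "exp (- (2 * (h * r))) \<le> exp (ln (1 - h * r))" by simp
  also have "\<dots> = 1 - h * r" using assms(3) by simp
  also have "\<dots> \<le> norm (1 + of_real h * \<zeta>)"
    using norm_triangle_ineq2[of 1 "- (of_real h * \<zeta>)"] hz by simp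
  finally have lower: "exp (- (2 * (h * r))) \<le> norm (1 + of_real h * \<zeta>)" .
  then show "1 + of_real h * \<zeta> \<noteq> 0" by (metis exp_gt_zero norm_zero not_le)
  have "norm (inverse (1 + of_real h * \<zeta>)) \<le> inverse (exp (- (2 * (h * r))))"
    unfolding norm_inverse using lower by (intro le_imp_inverse_le) auto
  also have "\<dots> = exp (2 * (h * r))" by (simp add: exp_minus)
  finally show "norm (inverse (1 + of_real h * \<zeta>) ^ k) \<le> exp (2 * r * (h * real k))"
    unfolding norm_power exp_k[symmetric] by (intro power_mono) auto
qed

section \<open>Sections and tails at the scale of the square root of n\<close>

text \<open>One statement for both halves: \<sigma> = -1, d = 0 and v = 1/u give sections, while
  \<sigma> = 1, d = 1 and v = u give tails. The zero branch of \<open>f\<close> extends the finite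
  section to a series.\<close>

lemma ml_sum_tendsto:
  fixes \<rho> b \<sigma> :: real and d :: nat and m :: "nat \<Rightarrow> nat" and v :: "nat \<Rightarrow> complex"
  assumes \<rho>: "\<rho> > 1" and m: "filterlim m at_top sequentially" and \<sigma>: "\<bar>\<sigma>\<bar> = 1" and b: "b \<ge> 0"
    and h_def: "h = (\<lambda>i. sqrt (2 / (\<rho> * real (m i))))"
    and v: "\<And>k x. (\<lambda>i. h i * real (k i)) \<longlonglongrightarrow> x \<Longrightarrow> (\<lambda>i. v i ^ k i) \<longlonglongrightarrow> exp (- of_real x * \<zeta>)"
    and v_le: "\<forall>\<^sub>F i in sequentially. \<forall>k. norm (v i ^ k) \<le> exp (b * (h i * real k))"
  defines "f \<equiv> \<lambda>i k. if real (m i) + \<sigma> * real (k + d) \<ge> 0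
      then of_real (exp (ml_log_ratio \<rho> (m i) (\<sigma> * real (k + d)))) * v i ^ (k + d) else 0"
  shows "(\<lambda>i. of_real (h i) * (\<Sum>k. f i k)) \<longlonglongrightarrow> of_real (sqrt pi) * exp (\<zeta>\<^sup>2) * erfc \<zeta>"
    and "\<forall>\<^sub>F i in sequentially. summable (f i)"
proof -
  \<comment> \<open>The decay rate c - 1 = b + 1 absorbs the growth rate b of the powers of v and
    leaves exp(-hk).\<close>
  define c where "c = b + 2"
  have real_m: "filterlim (\<lambda>i. real (m i)) at_top sequentially"
    by (rule filterlim_compose[OF filterlim_real_sequentially m])
  have h0: "h \<longlonglongrightarrow> 0"
    unfolding h_def by (rule filterlim_compose[OF _ real_m]) (use \<rho> in real_asymp)
  have h_pos: "\<forall>\<^sub>F i in sequentially. h i > 0"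
    using eventually_compose_filterlim[OF eventually_gt_at_top m, of 0]
    by eventually_elim (use \<rho> in \<open>auto simp: h_def\<close>)
  have "(\<lambda>i. 4 * c * \<rho> * h i) \<longlonglongrightarrow> 4 * c * \<rho> * 0"
    by (intro tendsto_intros h0)
  then have small: "\<forall>\<^sub>F i in sequentially. 4 * c * \<rho> * h i < 1"
    by (rule order_tendstoD) simp
  have bound: "\<forall>\<^sub>F i in sequentially. \<forall>k. norm (f i k) \<le> exp (16 * c\<^sup>2) * exp (- (h i * real k))"
    using h_pos small v_le eventually_compose_filterlim[OF eventually_ge_at_top real_m, of \<rho>]
  proof eventually_elim
    case (elim i)
    show ?case
    proof
      fix k
      show "norm (f i k) \<le> exp (16 * c\<^sup>2) * exp (- (h i * real k))"
      proof (cases "real (m i) + \<sigma> * real (k + d) \<ge> 0")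
        case True
        have t: "\<bar>\<sigma> * real (k + d)\<bar> = real (k + d)" using \<sigma> by (simp add: abs_mult)
        have "ml_log_ratio \<rho> (m i) (\<sigma> * real (k + d))
            \<le> 16 * c\<^sup>2 - (c - 1) * (h i * real (k + d))"
          using ml_log_ratio_le[OF \<rho> elim(4), of c "\<sigma> * real (k + d)"] elim(2) True b
          unfolding t h_def by (simp add: c_def)
        moreover have "norm (f i k) = exp (ml_log_ratio \<rho> (m i) (\<sigma> * real (k + d))) * norm (v i ^ (k + d))"
          using True by (simp add: f_def norm_mult)
        ultimately have "norm (f i k)
            \<le> exp (16 * c\<^sup>2 - (c - 1) * (h i * real (k + d))) * exp (b * (h i * real (k + d)))"
          using elim(3)[rule_format, of "k + d"] by (simp only:) (intro mult_mono, simp_all)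
        also have "\<dots> = exp (16 * c\<^sup>2) * exp (- (h i * real (k + d)))"
          by (simp add: c_def algebra_simps flip: exp_add)
        also have "\<dots> \<le> exp (16 * c\<^sup>2) * exp (- (h i * real k))"
          using elim(1) by (simp add: algebra_simps)
        finally show ?thesis .
      qed (simp add: f_def)
    qed
  qed
  have lim: "(\<lambda>i. f i (k i)) \<longlonglongrightarrow> exp (- (of_real x)\<^sup>2 / 4 - of_real x * \<zeta>)"
    if k: "(\<lambda>i. h i * real (k i)) \<longlonglongrightarrow> x" for x k
  proof -
    have "(\<lambda>i. h i * real (k i) + h i * real d) \<longlonglongrightarrow> x + 0 * real d"
      by (intro tendsto_intros k h0)
    then have kd: "(\<lambda>i. h i * real (k i + d)) \<longlonglongrightarrow> x" by (simp add: distrib_left)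
    have "(\<lambda>i. \<sigma> * (h i * real (k i + d))) \<longlonglongrightarrow> \<sigma> * x"
      by (intro tendsto_intros kd)
    then have "(\<lambda>i. ml_log_ratio \<rho> (m i) (\<sigma> * real (k i + d))) \<longlonglongrightarrow> - ((\<sigma> * x)\<^sup>2 / 4)"
      unfolding h_def by (intro ml_log_ratio_tendsto \<rho> m) (simp add: mult_ac)
    also have "(\<sigma> * x)\<^sup>2 = x\<^sup>2"
      using \<sigma> by (metis abs_mult mult_1 power2_abs)
    finally have L: "(\<lambda>i. ml_log_ratio \<rho> (m i) (\<sigma> * real (k i + d))) \<longlonglongrightarrow> - (x\<^sup>2 / 4)" .
    have "(\<lambda>i. of_real (exp (ml_log_ratio \<rho> (m i) (\<sigma> * real (k i + d)))) * v i ^ (k i + d))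
        \<longlonglongrightarrow> of_real (exp (- (x\<^sup>2 / 4))) * exp (- of_real x * \<zeta>)"
      by (intro tendsto_intros L v kd)
    also have "of_real (exp (- (x\<^sup>2 / 4))) * exp (- of_real x * \<zeta>)
        = exp (- (of_real x)\<^sup>2 / 4 - of_real x * \<zeta>)"
      by (simp add: exp_of_real[symmetric] exp_add[symmetric] exp_diff exp_minus field_simps)
    finally have F: "(\<lambda>i. of_real (exp (ml_log_ratio \<rho> (m i) (\<sigma> * real (k i + d)))) * v i ^ (k i + d))
        \<longlonglongrightarrow> exp (- (of_real x)\<^sup>2 / 4 - of_real x * \<zeta>)" .
    \<comment> \<open>The zero branch is eventually inactive: multiplied by h^2, the index m +
      \<sigma>(k + d) tends to 2/\<rho> > 0, because h(k + d) stays bounded.\<close>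
    have "(\<lambda>i. (h i)\<^sup>2 * real (m i)) \<longlonglongrightarrow> 2 / \<rho>"
    proof (rule Lim_transform_eventually[OF tendsto_const])
      show "\<forall>\<^sub>F i in sequentially. 2 / \<rho> = (h i)\<^sup>2 * real (m i)"
        using eventually_compose_filterlim[OF eventually_gt_at_top m, of 0]
        by eventually_elim (use \<rho> in \<open>simp add: h_def\<close>)
    qed
    moreover have "(\<lambda>i. h i * (\<sigma> * (h i * real (k i + d)))) \<longlonglongrightarrow> 0 * (\<sigma> * x)"
      by (intro tendsto_intros kd h0)
    ultimately have "(\<lambda>i. (h i)\<^sup>2 * real (m i) + h i * (\<sigma> * (h i * real (k i + d)))) \<longlonglongrightarrow> 2 / \<rho> + 0 * (\<sigma> * x)"
      by (rule tendsto_add)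
    then have "\<forall>\<^sub>F i in sequentially. 0 < (h i)\<^sup>2 * real (m i) + h i * (\<sigma> * (h i * real (k i + d)))"
      using \<rho> by (intro order_tendstoD) auto
    then have "\<forall>\<^sub>F i in sequentially. real (m i) + \<sigma> * real (k i + d) \<ge> 0"
    proof (rule eventually_rev_mp, intro always_eventually allI impI)
      fix i
      assume "0 < (h i)\<^sup>2 * real (m i) + h i * (\<sigma> * (h i * real (k i + d)))"
      also have "\<dots> = (h i)\<^sup>2 * (real (m i) + \<sigma> * real (k i + d))"
        by (simp add: power2_eq_square algebra_simps)
      finally show "real (m i) + \<sigma> * real (k i + d) \<ge> 0"
        by (simp add: zero_less_mult_iff)
    qed
    then have "\<forall>\<^sub>F i in sequentially.
        of_real (exp (ml_log_ratio \<rho> (m i) (\<sigma> * real (k i + d)))) * v i ^ (k i + d) = f i (k i)"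
      by eventually_elim (simp add: f_def)
    with F show ?thesis by (rule Lim_transform_eventually)
  qed
  have meas: "(\<lambda>x. exp (- (complex_of_real x)\<^sup>2 / 4 - of_real x * \<zeta>)) \<in> borel_measurable borel"
    by (intro borel_measurable_continuous_onI continuous_intros) auto
  have R: "integrable lborel (\<lambda>x. indicator {0..} x *\<^sub>R exp (- (complex_of_real x)\<^sup>2 / 4 - of_real x * \<zeta>))"
    by (rule riemann_sums_dominated(1)[OF h0 h_pos bound _ meas]) (rule lim)
  show "(\<lambda>i. of_real (h i) * (\<Sum>k. f i k)) \<longlonglongrightarrow> of_real (sqrt pi) * exp (\<zeta>\<^sup>2) * erfc \<zeta>"
    unfolding gaussian_half_line_integral[OF R, symmetric]
    by (rule riemann_sums_dominated(2)[OF h0 h_pos bound _ meas]) (rule lim)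
  show "\<forall>\<^sub>F i in sequentially. summable (f i)"
    using h_pos bound
  proof eventually_elim
    case (elim i)
    show ?case
      by (rule summable_comparison_test'[OF summable_mult[OF summable_exp_mesh[OF elim(1)]]])
         (use elim(2) in auto)
  qed
qed

section \<open>Sections, tails and the full series relative to the term of index n\<close>

text \<open>All Gamma values are positive, so \<open>R_n\<close> and the terms are exponentials and
  the claim is an identity of exponents. The difference k - n is taken in the reals, hence k < n is
  included.\<close>

lemma ml_term_ratio:
  assumes "\<rho> > 1" "n > 0"
  shows "ml_term \<rho> k (of_real (ml_R \<rho> n) * u)
    = ml_term \<rho> n (of_real (ml_R \<rho> n)) * (of_real (exp (ml_log_ratio \<rho> n (real k - real n))) * u ^ k)"
proof -
  define \<delta> where "\<delta> = ln_Gamma (1 + real n / \<rho>) - ln_Gamma (1 + (real n - 1) / \<rho>)"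
  have pos: "1 + real j / \<rho> > 0" for j using assms(1) by (simp add: add_pos_nonneg)
  have "1 + (real n - 1) / \<rho> > 0" using assms by (simp add: add_pos_nonneg)
  then have R: "ml_R \<rho> n = exp \<delta>"
    using pos[of n] by (simp add: ml_R_def \<delta>_def Gamma_real_pos_exp exp_diff)
  have terms: "ml_term \<rho> j (of_real (ml_R \<rho> n) * u)
      = of_real (exp (real j * \<delta> - ln_Gamma (1 + real j / \<rho>))) * u ^ j" for j u
    using pos[of j]
    by (simp add: ml_term_def R Gamma_real_pos_exp exp_diff exp_of_nat_mult power_mult_distrib)
  have "real k * \<delta> - ln_Gamma (1 + real k / \<rho>)
      = (real n * \<delta> - ln_Gamma (1 + real n / \<rho>)) + ml_log_ratio \<rho> n (real k - real n)"
    unfolding ml_log_ratio_def \<delta>_def[symmetric] by (simp add: algebra_simps)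
  then show ?thesis
    using terms[of k u] terms[of n 1] by (simp add: exp_add)
qed

text \<open>The section at \<open>R_n w\<close> read downwards from index n and divided by its n-th
  term.\<close>

definition ml_lower_sum :: "real \<Rightarrow> nat \<Rightarrow> complex \<Rightarrow> complex" where
  "ml_lower_sum \<rho> n w = (\<Sum>k\<le>n. of_real (exp (ml_log_ratio \<rho> n (- real k))) * inverse w ^ k)"

text \<open>The term of index n + 1 + k under the same normalisation; kept as a sequence because its
  summability has to be tracked.\<close>

definition ml_upper_term :: "real \<Rightarrow> nat \<Rightarrow> complex \<Rightarrow> nat \<Rightarrow> complex" where
  "ml_upper_term \<rho> n w k = of_real (exp (ml_log_ratio \<rho> n (real (k + 1)))) * w ^ (k + 1)"

lemma ml_section_eq:
  assumes "\<rho> > 1" "n > 0" "w \<noteq> 0"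
  shows "ml_section \<rho> n (of_real (ml_R \<rho> n) * w)
    = ml_term \<rho> n (of_real (ml_R \<rho> n)) * w ^ n * ml_lower_sum \<rho> n w"
proof -
  have "ml_section \<rho> n (of_real (ml_R \<rho> n) * w)
      = (\<Sum>k\<le>n. ml_term \<rho> (n - k) (of_real (ml_R \<rho> n) * w))"
    unfolding ml_section_def
    by (rule sum.nat_diff_reindex[of _ "Suc n", symmetric, simplified lessThan_Suc_atMost, simplified])
  also have "\<dots> = (\<Sum>k\<le>n. ml_term \<rho> n (of_real (ml_R \<rho> n)) * w ^ n *
      (of_real (exp (ml_log_ratio \<rho> n (- real k))) * inverse w ^ k))"
    by (rule sum.cong)
       (use assms in \<open>auto simp: ml_term_ratio of_nat_diff power_diff power_inverse divide_inverse\<close>)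
  finally show ?thesis by (simp add: ml_lower_sum_def sum_distrib_left)
qed

lemma ml_tail_eq:
  assumes "\<rho> > 1" "n > 0" and sum: "summable (ml_upper_term \<rho> n w)"
  shows "ml_tail \<rho> (n + 1) (of_real (ml_R \<rho> n) * w)
      = ml_term \<rho> n (of_real (ml_R \<rho> n)) * w ^ n * suminf (ml_upper_term \<rho> n w)"
    and "summable (\<lambda>k. ml_term \<rho> k (of_real (ml_R \<rho> n) * w))"
proof -
  have tail: "ml_term \<rho> (k + (n + 1)) (of_real (ml_R \<rho> n) * w)
      = ml_term \<rho> n (of_real (ml_R \<rho> n)) * w ^ n * ml_upper_term \<rho> n w k" for k
    unfolding ml_term_ratio[OF assms(1,2)] by (simp add: ml_upper_term_def power_add)
  show "ml_tail \<rho> (n + 1) (of_real (ml_R \<rho> n) * w)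
      = ml_term \<rho> n (of_real (ml_R \<rho> n)) * w ^ n * suminf (ml_upper_term \<rho> n w)"
    unfolding ml_tail_def tail by (rule suminf_mult[OF sum])
  have "summable (\<lambda>k. ml_term \<rho> (k + (n + 1)) (of_real (ml_R \<rho> n) * w))"
    unfolding tail by (rule summable_mult[OF sum])
  then show "summable (\<lambda>k. ml_term \<rho> k (of_real (ml_R \<rho> n) * w))"
    by (rule summable_iff_shift[THEN iffD1])
qed

lemma mittag_leffler_eq:
  assumes "\<rho> > 1" "n > 0" "w \<noteq> 0" "summable (ml_upper_term \<rho> n w)"
  shows "mittag_leffler \<rho> (of_real (ml_R \<rho> n) * w)
    = ml_term \<rho> n (of_real (ml_R \<rho> n)) * w ^ n * (ml_lower_sum \<rho> n w + suminf (ml_upper_term \<rho> n w))"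
proof -
  have "mittag_leffler \<rho> (of_real (ml_R \<rho> n) * w)
      = ml_tail \<rho> (n + 1) (of_real (ml_R \<rho> n) * w) + ml_section \<rho> n (of_real (ml_R \<rho> n) * w)"
    \<comment> \<open>Splitting the series at n + 1 requires convergence of the whole series, which
      follows from that of its tail.\<close>
    using suminf_split_initial_segment[OF ml_tail_eq(2)[OF assms(1,2,4)], of "n + 1"]
    by (simp add: mittag_leffler_def ml_tail_def ml_section_def lessThan_Suc_atMost)
  then show ?thesis
    unfolding ml_tail_eq(1)[OF assms(1,2,4)] ml_section_eq[OF assms(1-3)] by (simp add: algebra_simps)
qed

lemma ml_partial_sums_tendsto:
  fixes \<rho> :: real and m :: "nat \<Rightarrow> nat" and z :: "nat \<Rightarrow> complex"
  assumes \<rho>: "\<rho> > 1" and m: "filterlim m at_top sequentially" and z: "z \<longlonglongrightarrow> z0"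
    and h_def: "h = (\<lambda>i. sqrt (2 / (\<rho> * real (m i))))"
  defines "u \<equiv> \<lambda>i. 1 + complex_of_real (h i) * z i"
  shows "(\<lambda>i. h i * ml_lower_sum \<rho> (m i) (u i)) \<longlonglongrightarrow> of_real (sqrt pi) * exp (z0\<^sup>2) * erfc z0"
    and "(\<lambda>i. h i * suminf (ml_upper_term \<rho> (m i) (u i))) \<longlonglongrightarrow> of_real (sqrt pi) * exp (z0\<^sup>2) * erfc (- z0)"
    and "\<forall>\<^sub>F i in sequentially. m i > 0 \<and> u i \<noteq> 0 \<and> summable (ml_upper_term \<rho> (m i) (u i))"
proof -
  have real_m: "filterlim (\<lambda>i. real (m i)) at_top sequentially"
    by (rule filterlim_compose[OF filterlim_real_sequentially m])
  have h0: "h \<longlonglongrightarrow> 0"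
    unfolding h_def by (rule filterlim_compose[OF _ real_m]) (use \<rho> in real_asymp)
  have h_nonneg: "h i \<ge> 0" for i
    using \<rho> by (simp add: h_def)
  have m_pos: "\<forall>\<^sub>F i in sequentially. m i > 0"
    by (rule eventually_compose_filterlim[OF eventually_gt_at_top m])
  \<comment> \<open>A convergent sequence is bounded, so one rate 2r works for all i.\<close>
  obtain r where r: "\<And>i. norm (z i) \<le> r" and "r > 0"
    using convergent_imp_Bseq[OF convergentI[OF z]] by (auto simp: Bseq_def)
  have "(\<lambda>i. h i * r) \<longlonglongrightarrow> 0 * r" by (intro tendsto_intros h0)
  then have hr: "\<forall>\<^sub>F i in sequentially. h i * r < 1 / 2" by (rule order_tendstoD) simp
  \<comment> \<open>The double sign shows that the tails use \<zeta> = -z0, whence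
    erfc(-z0).\<close>
  have up: "(\<lambda>i. u i ^ k i) \<longlonglongrightarrow> exp (- of_real x * - z0)"
    if "(\<lambda>i. h i * real (k i)) \<longlonglongrightarrow> x" for k x
    using one_plus_mesh_power_tendsto[OF h0 z that] by (simp add: u_def)
  have down: "(\<lambda>i. inverse (u i) ^ k i) \<longlonglongrightarrow> exp (- of_real x * z0)"
    if "(\<lambda>i. h i * real (k i)) \<longlonglongrightarrow> x" for k x
    using tendsto_inverse[OF up[OF that]] by (simp add: power_inverse exp_minus)
  have up_le: "\<forall>\<^sub>F i in sequentially. \<forall>k. norm (u i ^ k) \<le> exp (2 * r * (h i * real k))"
    and down_le: "\<forall>\<^sub>F i in sequentially. \<forall>k. norm (inverse (u i) ^ k) \<le> exp (2 * r * (h i * real k))"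
    and nz: "\<forall>\<^sub>F i in sequentially. u i \<noteq> 0"
    using hr one_plus_mesh_power_le[OF r h_nonneg] unfolding u_def
    by (auto elim!: eventually_mono)
  have r2: "2 * r \<ge> 0" using \<open>r > 0\<close> by simp
  \<comment> \<open>The redundant \<open>-1 *\<close> and \<open>+ 0\<close> spell out \<sigma> and
    d for unification.\<close>
  have lower: "ml_lower_sum \<rho> n w = (\<Sum>k. if real n + -1 * real (k + 0) \<ge> 0
      then of_real (exp (ml_log_ratio \<rho> n (-1 * real (k + 0)))) * inverse w ^ (k + 0) else 0)" for n w
    by (subst suminf_finite[of "{..n}"]) (auto simp: ml_lower_sum_def)
  have upper: "ml_upper_term \<rho> n w = (\<lambda>k. if real n + 1 * real (k + 1) \<ge> 0
      then of_real (exp (ml_log_ratio \<rho> n (1 * real (k + 1)))) * w ^ (k + 1) else 0)" for n w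
    by (auto simp: ml_upper_term_def)
  show "(\<lambda>i. h i * ml_lower_sum \<rho> (m i) (u i)) \<longlonglongrightarrow> of_real (sqrt pi) * exp (z0\<^sup>2) * erfc z0"
    unfolding lower by (rule ml_sum_tendsto(1)[OF \<rho> m _ r2 h_def _ down_le]) (simp, rule down)
  have "(\<lambda>i. h i * suminf (ml_upper_term \<rho> (m i) (u i))) \<longlonglongrightarrow> of_real (sqrt pi) * exp ((- z0)\<^sup>2) * erfc (- z0)"
    unfolding upper by (rule ml_sum_tendsto(1)[OF \<rho> m _ r2 h_def _ up_le]) (simp, rule up)
  then show "(\<lambda>i. h i * suminf (ml_upper_term \<rho> (m i) (u i)))
      \<longlonglongrightarrow> of_real (sqrt pi) * exp (z0\<^sup>2) * erfc (- z0)"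
    by simp
  have "\<forall>\<^sub>F i in sequentially. summable (ml_upper_term \<rho> (m i) (u i))"
    unfolding upper by (rule ml_sum_tendsto(2)[OF \<rho> m _ r2 h_def _ up_le]) (simp, rule up)
  with m_pos nz show "\<forall>\<^sub>F i in sequentially. m i > 0 \<and> u i \<noteq> 0 \<and> summable (ml_upper_term \<rho> (m i) (u i))"
    by eventually_elim simp
qed

section \<open>The limit of the normalised quotient\<close>

theorem theorem3:
  fixes \<rho> :: real and lam :: complex and K :: "complex set"
  assumes "\<rho> > 1" and "compact K"
  shows "uniform_limit K
    (\<lambda>n \<zeta>. (1 + of_real (sqrt (2 / (\<rho> * real n))) * \<zeta>) powi (- int n)
          * inverse (mittag_leffler \<rho> (of_real (ml_R \<rho> n)))
          * ml_I \<rho> lam n (of_real (ml_R \<rho> n) * (1 + of_real (sqrt (2 / (\<rho> * real n))) * \<zeta>)))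
    (\<lambda>\<zeta>. exp (\<zeta>\<^sup>2) * (erfc \<zeta> / 2 - lam))
    sequentially"
proof (rule uniform_limit_compactI[OF assms(2)])
  obtain \<Phi> where \<Phi>: "\<And>z. (\<Phi> has_field_derivative exp (- z\<^sup>2)) (at z)"
    "\<And>z. erfc z = 1 - 2 / of_real (sqrt pi) * (\<Phi> z - \<Phi> 0)"
    by (rule erfc_primitive) blast
  have "continuous_on K \<Phi>"
    using \<Phi>(1) by (meson DERIV_isCont continuous_at_imp_continuous_on)
  then show "continuous_on K (\<lambda>\<zeta>. exp (\<zeta>\<^sup>2) * (erfc \<zeta> / 2 - lam))"
    unfolding \<Phi>(2) by (intro continuous_intros) auto
next
  fix m :: "nat \<Rightarrow> nat" and z :: "nat \<Rightarrow> complex" and z0 :: complex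
  assume m: "filterlim m at_top sequentially" and z: "z \<longlonglongrightarrow> z0"
  define h where "h = (\<lambda>i. sqrt (2 / (\<rho> * real (m i))))"
  define u where "u = (\<lambda>i. 1 + complex_of_real (h i) * z i)"
  define S where "S = (\<lambda>w i. ml_lower_sum \<rho> (m i) w)"
  define T where "T = (\<lambda>w i. suminf (ml_upper_term \<rho> (m i) w))"
  define c where "c = complex_of_real (sqrt pi)"
  have c: "c \<noteq> 0" by (simp add: c_def)
  have at_z: "(\<lambda>i. h i * S (u i) i) \<longlonglongrightarrow> c * exp (z0\<^sup>2) * erfc z0"
      "(\<lambda>i. h i * T (u i) i) \<longlonglongrightarrow> c * exp (z0\<^sup>2) * erfc (- z0)"
      "\<forall>\<^sub>F i in sequentially. m i > 0 \<and> u i \<noteq> 0 \<and> summable (ml_upper_term \<rho> (m i) (u i))"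
    unfolding S_def T_def u_def c_def by (rule ml_partial_sums_tendsto[OF assms(1) m z h_def])+
  \<comment> \<open>The constant sequence z = 0 gives u = 1, hence the asymptotics of E(R_n); here
    erfc(0) = 1.\<close>
  have at_0: "(\<lambda>i. h i * S 1 i) \<longlonglongrightarrow> c" "(\<lambda>i. h i * T 1 i) \<longlonglongrightarrow> c"
      "\<forall>\<^sub>F i in sequentially. summable (ml_upper_term \<rho> (m i) 1)"
    using ml_partial_sums_tendsto[OF assms(1) m tendsto_const[of 0] h_def]
    by (auto simp: S_def T_def c_def erfc_def elim: eventually_mono)
  \<comment> \<open>The numerator reflects (1 - \<lambda>)S - \<lambda>T = S - \<lambda>(S + T).
    Since erfc(z0) + erfc(-z0) = 2, the limit collapses to the stated one.\<close>
  have "(\<lambda>i. (h i * S (u i) i - lam * (h i * S (u i) i + h i * T (u i) i)) / (h i * S 1 i + h i * T 1 i)) \<longlonglongrightarrow>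
      (c * exp (z0\<^sup>2) * erfc z0 - lam * (c * exp (z0\<^sup>2) * erfc z0 + c * exp (z0\<^sup>2) * erfc (- z0)))
        / (c + c)"
    using c by (intro at_z(1,2) at_0(1,2) tendsto_divide tendsto_diff tendsto_add tendsto_mult_left) simp
  also have "(c * exp (z0\<^sup>2) * erfc z0 - lam * (c * exp (z0\<^sup>2) * erfc z0 + c * exp (z0\<^sup>2) * erfc (- z0)))
        / (c + c) = exp (z0\<^sup>2) * (erfc z0 / 2 - lam)"
    using c by (simp add: erfc_minus field_simps)
  finally have lim: "(\<lambda>i. (h i * S (u i) i - lam * (h i * S (u i) i + h i * T (u i) i)) / (h i * S 1 i + h i * T 1 i))
      \<longlonglongrightarrow> exp (z0\<^sup>2) * (erfc z0 / 2 - lam)" .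
  have "\<forall>\<^sub>F i in sequentially.
      (h i * S (u i) i - lam * (h i * S (u i) i + h i * T (u i) i)) / (h i * S 1 i + h i * T 1 i)
      = u i powi (- int (m i)) * inverse (mittag_leffler \<rho> (of_real (ml_R \<rho> (m i))))
          * ml_I \<rho> lam (m i) (of_real (ml_R \<rho> (m i)) * u i)"
    using at_z(3) at_0(3)
  proof eventually_elim
    case (elim i)
    define A where "A = ml_term \<rho> (m i) (of_real (ml_R \<rho> (m i)))"
    have i: "m i > 0" "u i \<noteq> 0" using elim by auto
    then have "0 < h i" using assms(1) by (simp add: h_def)
    have "0 < ml_R \<rho> (m i)"
      unfolding ml_R_def using assms(1) i by (intro divide_pos_pos Gamma_real_pos add_pos_nonneg) auto
    moreover have "0 < Gamma (1 + real (m i) / \<rho>)"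
      using assms(1) by (intro Gamma_real_pos add_pos_nonneg) auto
    \<comment> \<open>The n-th term at R_n is a common factor of I_n and E(R_n), and being nonzero
      it cancels.\<close>
    ultimately have A: "A \<noteq> 0" by (simp add: A_def ml_term_def)
    have E: "mittag_leffler \<rho> (of_real (ml_R \<rho> (m i))) = A * (S 1 i + T 1 i)"
      using mittag_leffler_eq[of \<rho> "m i" 1] assms(1) elim by (simp add: A_def S_def T_def)
    have "ml_I \<rho> lam (m i) (of_real (ml_R \<rho> (m i)) * u i)
        = (1 - lam) * (A * u i ^ m i * S (u i) i) - lam * (A * u i ^ m i * T (u i) i)"
      using ml_section_eq[OF assms(1) i] ml_tail_eq(1)[OF assms(1) i(1)] elim
      by (simp add: ml_I_def A_def S_def T_def)
    then have I: "ml_I \<rho> lam (m i) (of_real (ml_R \<rho> (m i)) * u i)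
        = u i ^ m i * A * (S (u i) i - lam * (S (u i) i + T (u i) i))"
      by (simp add: algebra_simps)
    have P: "u i powi (- int (m i)) * u i ^ m i = 1"
      using i by (simp add: power_int_minus)
    have "u i powi (- int (m i)) * inverse (A * (S 1 i + T 1 i))
          * (u i ^ m i * A * (S (u i) i - lam * (S (u i) i + T (u i) i)))
        = (u i powi (- int (m i)) * u i ^ m i) * (A * inverse A)
          * ((S (u i) i - lam * (S (u i) i + T (u i) i)) * inverse (S 1 i + T 1 i))"
      by (simp only: inverse_mult_distrib mult_ac)
    \<comment> \<open>Expanding the fraction by h > 0 brings in the scaled sums whose limits are
      known.\<close>
    also have "\<dots> = (h i * (S (u i) i - lam * (S (u i) i + T (u i) i))) / (h i * (S 1 i + T 1 i))"
      using A \<open>0 < h i\<close> unfolding P by (simp add: divide_inverse)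
    also have "\<dots> = (h i * S (u i) i - lam * (h i * S (u i) i + h i * T (u i) i)) / (h i * S 1 i + h i * T 1 i)"
      by (simp add: algebra_simps)
    finally show ?case unfolding E I by simp
  qed
  from Lim_transform_eventually[OF lim this]
  show "(\<lambda>i. (1 + of_real (sqrt (2 / (\<rho> * real (m i)))) * z i) powi (- int (m i))
          * inverse (mittag_leffler \<rho> (of_real (ml_R \<rho> (m i))))
          * ml_I \<rho> lam (m i) (of_real (ml_R \<rho> (m i)) * (1 + of_real (sqrt (2 / (\<rho> * real (m i)))) * z i)))
      \<longlonglongrightarrow> exp (z0\<^sup>2) * (erfc z0 / 2 - lam)"
    unfolding u_def h_def .
qed

end
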